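(* Let $\bar y$ be a first-stage vector with $t^\star(\bar y)>0$, where $t^\star(\bar y):=\min_{x\ge 0,\ t\ge 0}\{t:\ Bx+t\,\mathbf e\ge d(\bar y)\}$. Consider the problem $$\max_{\lambda}\{d(\bar y)^\top\lambda:\ B^\top\lambda\le 0,\ \lambda\ge 0,\ \mathbf e^\top\lambda\le 1\}.$$ Then every optimal solution $\lambda$ of this problem satisfies $\mathbf e^\top\lambda=1$, and an optimal solution can be chosen at an extreme point of the slice $$\mathcal S_{\mathbf e}:=\{\lambda:\ \lambda\ge 0,\ B^\top\lambda\le 0,\ \mathbf e^\top\lambda=1\},$$ and this extreme point generates (i.e. corresponds up to positive scaling to) an extreme ray of the cone $\mathcal R:=\{\lambda\ge 0:\ B^\top\lambda\le 0\}$.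
   Context: Data: real matrices $A,B$ and a real vector $b$ of compatible dimensions; $d(y):=b-Ay$. $\mathbf e$ is the all-ones vector. All vector inequalities are componentwise. A nonzero $r\in\mathcal R$ generates an extreme ray of $\mathcal R$ if $r=u_1+u_2$ with $u_1,u_2\in\mathcal R$ implies that $u_1$ and $u_2$ are nonnegative multiples of $r$. *)

theory Defs
  imports "HOL-Analysis.Analysis"
begin

text \<open>
  On \<open>real ^ 'k\<close> the order \<open>\<le>\<close> is componentwise and \<open>1\<close> is the all-ones vector.
\<close>

definition rhs :: "real ^ 'p ^ 'm \<Rightarrow> real ^ 'm \<Rightarrow> real ^ 'p \<Rightarrow> real ^ 'm"
  where "rhs A b y = b - A *v y"

definition primal_feasible :: "real ^ 'n ^ 'm \<Rightarrow> real ^ 'm \<Rightarrow> ((real ^ 'n) \<times> real) set"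
  where "primal_feasible B d = {(x, t). 0 \<le> x \<and> 0 \<le> t \<and> d \<le> B *v x + t *\<^sub>R 1}"

text \<open>The minimum is attained by \<open>t_star_attained\<close> below, so \<open>LEAST\<close> is well defined here.\<close>

definition t_star ::
    "real ^ 'p ^ 'm \<Rightarrow> real ^ 'n ^ 'm \<Rightarrow> real ^ 'm \<Rightarrow> real ^ 'p \<Rightarrow> real"
  where "t_star A B b y = (LEAST t. \<exists>x. (x, t) \<in> primal_feasible B (rhs A b y))"

definition dual_feasible :: "real ^ 'n ^ 'm \<Rightarrow> (real ^ 'm) set"
  where "dual_feasible B = {l. transpose B *v l \<le> 0 \<and> 0 \<le> l \<and> 1 \<bullet> l \<le> 1}"

definition dual_optimal ::
    "real ^ 'p ^ 'm \<Rightarrow> real ^ 'n ^ 'm \<Rightarrow> real ^ 'm \<Rightarrow> real ^ 'p \<Rightarrow> real ^ 'm \<Rightarrow> bool"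
  where "dual_optimal A B b y = is_arg_max (\<lambda>l. rhs A b y \<bullet> l) (\<lambda>l. l \<in> dual_feasible B)"

definition slice :: "real ^ 'n ^ 'm \<Rightarrow> (real ^ 'm) set"
  where "slice B = {l. 0 \<le> l \<and> transpose B *v l \<le> 0 \<and> 1 \<bullet> l = 1}"

definition ray_cone :: "real ^ 'n ^ 'm \<Rightarrow> (real ^ 'm) set"
  where "ray_cone B = {l. 0 \<le> l \<and> transpose B *v l \<le> 0}"

definition generates_extreme_ray :: "'a::real_vector \<Rightarrow> 'a set \<Rightarrow> bool"
  where "generates_extreme_ray r R \<longleftrightarrow>
    r \<in> R \<and> r \<noteq> 0 \<and>
    (\<forall>u\<^sub>1\<in>R. \<forall>u\<^sub>2\<in>R. r = u\<^sub>1 + u\<^sub>2 \<longrightarrow>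
      (\<exists>c\<ge>0. u\<^sub>1 = c *\<^sub>R r) \<and> (\<exists>c\<ge>0. u\<^sub>2 = c *\<^sub>R r))"

lemma convex_cone_orthant: "convex_cone {x :: real ^ 'k. 0 \<le> x}"
  by (auto simp: convex_cone_def convex_def conic_def less_eq_vec_def intro: exI[of _ 0])

lemma orthant_eq_convex_cone_hull:
  "{(x :: real ^ 'n, s :: real ^ 'm). 0 \<le> x \<and> 0 \<le> s} = convex_cone hull Basis"
    (is "?O = _")
proof
  have "convex_cone ?O"
    by (simp add: convex_cone_Times convex_cone_orthant)
  moreover have "Basis \<subseteq> ?O"
    by (auto simp: Basis_prod_def Basis_vec_def less_eq_vec_def axis_def)
  ultimately show "convex_cone hull Basis \<subseteq> ?O"
    by (simp add: hull_minimal)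
  show "?O \<subseteq> convex_cone hull Basis"
  proof
    fix z :: "(real ^ 'n) \<times> (real ^ 'm)"
    assume "z \<in> ?O"
    then have nn: "0 \<le> z \<bullet> u" if "u \<in> Basis" for u
      using that
      by (auto simp: Basis_prod_def Basis_vec_def less_eq_vec_def inner_axis)
    have "(\<Sum>u\<in>U. (z \<bullet> u) *\<^sub>R u) \<in> convex_cone hull Basis"
      if "finite U" "U \<subseteq> Basis" for U
      using that
      by (induction U rule: finite_induct)
        (auto intro!: convex_cone_hull_add convex_cone_hull_mul
          simp: convex_cone_hull_contains_0 nn hull_inc)
    from this[of Basis] show "z \<in> convex_cone hull Basis"
      by (simp add: euclidean_representation)
  qed
qed

lemma closed_primal_values:
  fixes B :: "real ^ 'n ^ 'm"
  shows "closed (snd ` primal_feasible B d)"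
proof -
  define f where "f = (\<lambda>z :: (real ^ 'n) \<times> (real ^ 'm). B *v fst z - snd z)"
  have lin: "linear f"
    unfolding f_def
    by (rule linearI) (auto simp: matrix_vector_right_distrib
        matrix_vector_mult_scaleR algebra_simps)
  let ?K = "f ` {(x, s). 0 \<le> x \<and> 0 \<le> s}"
  have "?K = convex_cone hull (f ` Basis)"
    by (simp only: orthant_eq_convex_cone_hull convex_cone_hull_linear_image[OF lin])
  then have "closed ?K"
    by (simp add: closed_convex_cone_hull)
  then have "closed ((\<lambda>t. d - t *\<^sub>R 1) -` ?K)"
    by (rule closed_vimage) (intro continuous_intros)
  moreover have "snd ` primal_feasible B d = {0..} \<inter> (\<lambda>t. d - t *\<^sub>R 1) -` ?K"
  proof (intro equalityI subsetI)
    fix t assume "t \<in> snd ` primal_feasible B d"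
    then obtain x where x: "0 \<le> x" "0 \<le> t" "d \<le> B *v x + t *\<^sub>R 1"
      by (auto simp: primal_feasible_def)
    then have "0 \<le> B *v x + t *\<^sub>R 1 - d"
      by (simp add: less_eq_vec_def)
    moreover have "d - t *\<^sub>R 1 = f (x, B *v x + t *\<^sub>R 1 - d)"
      by (simp add: f_def)
    ultimately show "t \<in> {0..} \<inter> (\<lambda>t. d - t *\<^sub>R 1) -` ?K"
      using x by auto
  next
    fix t assume "t \<in> {0..} \<inter> (\<lambda>t. d - t *\<^sub>R 1) -` ?K"
    then obtain x s where x: "0 \<le> x" "0 \<le> s" "0 \<le> t" "d - t *\<^sub>R 1 = B *v x - s"
      by (auto simp: f_def)
    then have "d = B *v x + t *\<^sub>R 1 - s"
      by (simp add: algebra_simps)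
    with x have "(x, t) \<in> primal_feasible B d"
      by (simp add: primal_feasible_def less_eq_vec_def)
    then show "t \<in> snd ` primal_feasible B d"
      by force
  qed
  ultimately show ?thesis
    by (simp add: closed_Int)
qed

lemma primal_feasible_nonempty: "primal_feasible B d \<noteq> {}"
proof -
  have "d $ i \<le> (\<Sum>j\<in>UNIV. \<bar>d $ j\<bar>)" for i
    using member_le_sum[of i UNIV "\<lambda>j. \<bar>d $ j\<bar>"] by auto
  then have "(0, \<Sum>j\<in>UNIV. \<bar>d $ j\<bar>) \<in> primal_feasible B d"
    by (auto simp: primal_feasible_def less_eq_vec_def sum_nonneg)
  then show ?thesis by blast
qed

lemma t_star_attained:
  "\<exists>x. (x, t_star A B b y) \<in> primal_feasible B (rhs A b y)"
  "(x, t) \<in> primal_feasible B (rhs A b y) \<Longrightarrow> t_star A B b y \<le> t"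
proof -
  let ?T = "snd ` primal_feasible B (rhs A b y)"
  have cl: "closed ?T"
    by (rule closed_primal_values)
  have ne: "?T \<noteq> {}"
    using primal_feasible_nonempty by blast
  have bdd: "bdd_below ?T"
    by (rule bdd_belowI[of _ 0]) (auto simp: primal_feasible_def)
  have mem: "Inf ?T \<in> ?T"
    by (rule closed_contains_Inf[OF ne bdd cl])
  have "t_star A B b y = Inf ?T"
    unfolding t_star_def
    by (rule Least_equality) (use mem in force, rule cInf_lower[OF _ bdd], force)
  with mem show "\<exists>x. (x, t_star A B b y) \<in> primal_feasible B (rhs A b y)"
    by force
  show "t_star A B b y \<le> t" if "(x, t) \<in> primal_feasible B (rhs A b y)"
    using \<open>t_star A B b y = Inf ?T\<close> cInf_lower[OF _ bdd, of t] that by force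
qed

end

theory Submission
  imports Defs
begin

text \<open>
  Write \<open>d\<close> for the right-hand side at the given first-stage vector, \<open>R\<close> for the ray cone and
  \<open>e\<close> for the all-ones vector.  Positivity of the optimal violation says that the system
  \<open>0 \<le> x\<close>, \<open>d \<le> B x\<close> has no solution, so Farkas' lemma (\<open>farkas\<close>) gives a ray in \<open>R\<close> on
  which \<open>d\<close> is positive.

  Since \<open>R\<close> lies in the orthant, \<open>e\<close> is positive on its nonzero elements
  (\<open>sum_pos_ray_cone\<close>), so the slice is a base of \<open>R\<close>: every nonzero ray is a positive multiple
  of a unique point of it.  It is compact and convex, so \<open>d\<close> attains its maximum \<open>v\<^sup>*\<close> over it
  at an extreme point (\<open>linear_max_at_extreme_point\<close>), and \<open>v\<^sup>* > 0\<close> because of the Farkas ray.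
  By homogeneity, \<open>d \<bullet> l \<le> (e \<bullet> l) v\<^sup>*\<close> on all of \<open>R\<close>.  For dual feasible \<open>l\<close>, where
  \<open>e \<bullet> l \<le> 1\<close>, this bound is at most \<open>v\<^sup>*\<close>, with equality only if \<open>e \<bullet> l = 1\<close>.  So \<open>v\<^sup>*\<close> is
  also the dual optimum, and every optimal solution lies on the slice.

  Finally, splitting a point of a base as a sum of two rays is, after normalising the two
  summands, writing it as a convex combination of base points; at an extreme point this is
  possible only trivially (\<open>extreme_point_of_cone_base_generates_extreme_ray\<close>).
\<close>

lemma conic_ray_cone: "conic (ray_cone B)"
  by (auto simp: conic_def ray_cone_def less_eq_vec_def matrix_vector_mult_scaleR
      mult_nonneg_nonpos simp del: transpose_matrix_vector)

lemma convex_ray_cone: "convex (ray_cone B)"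
  by (auto simp: convex_def ray_cone_def less_eq_vec_def matrix_vector_mult_scaleR
      matrix_vector_right_distrib mult_nonneg_nonpos add_nonpos_nonpos
      simp del: transpose_matrix_vector)

lemma closed_ray_cone:
  fixes B :: "real ^ 'n ^ 'm"
  shows "closed (ray_cone B)"
  unfolding ray_cone_def less_eq_vec_def
  by (intro closed_Collect_conj closed_Collect_all closed_Collect_le continuous_intros)

lemma dual_feasible_eq: "dual_feasible B = ray_cone B \<inter> {l. 1 \<bullet> l \<le> 1}"
  by (auto simp: dual_feasible_def ray_cone_def)

lemma slice_eq: "slice B = ray_cone B \<inter> {l. 1 \<bullet> l = 1}"
  by (auto simp: slice_def ray_cone_def)

lemma sum_pos_ray_cone:
  assumes "l \<in> ray_cone B" "l \<noteq> 0"
  shows "1 \<bullet> l > 0"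
proof -
  have nn: "0 \<le> l $ i" for i
    using assms(1) by (simp add: ray_cone_def less_eq_vec_def)
  obtain i where "l $ i \<noteq> 0"
    using assms(2) by (auto simp: vec_eq_iff)
  with nn[of i] have "0 < l $ i"
    by simp
  then have "0 < (\<Sum>j\<in>UNIV. l $ j)"
    by (intro sum_pos2[of _ i]) (auto simp: nn)
  then show ?thesis
    by (simp add: inner_vec_def)
qed

text \<open>Nonnegative entries with sum 1 confine the slice to the unit cube.\<close>

lemma compact_convex_slice:
  fixes B :: "real ^ 'n ^ 'm"
  shows "compact (slice B)" "convex (slice B)"
proof -
  have "closed (slice B)"
    unfolding slice_eq by (intro closed_Int closed_ray_cone closed_hyperplane)
  moreover have "slice B \<subseteq> cbox 0 1"
  proof
    fix l assume l: "l \<in> slice B"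
    then have nn: "0 \<le> l $ i" for i
      by (simp add: slice_def less_eq_vec_def)
    have "l $ i \<le> 1" for i
      using member_le_sum[of i UNIV "\<lambda>j. l $ j"] nn l
      by (simp add: slice_def inner_vec_def)
    with nn show "l \<in> cbox 0 1"
      by (simp add: mem_box_cart)
  qed
  ultimately show "compact (slice B)"
    using bounded_cbox bounded_subset compact_eq_bounded_closed by blast
  show "convex (slice B)"
    unfolding slice_eq by (intro convex_Int convex_ray_cone convex_hyperplane)
qed

text \<open>
  Solvability of the system means that \<open>d\<close> lies in the cone \<open>K\<close> of all \<open>B x - s\<close> with \<open>x\<close>
  and \<open>s\<close> nonnegative.  This cone is finitely generated, hence closed, so a point outside it
  can be strictly separated from it; minus the normal of the separating hyperplane is the
  required ray.
\<close>

lemma farkas: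
  fixes B :: "real ^ 'n ^ 'm"
  assumes "\<nexists>x. 0 \<le> x \<and> d \<le> B *v x"
  obtains l where "l \<in> ray_cone B" "d \<bullet> l > 0"
proof -
  define f where "f = (\<lambda>z :: (real ^ 'n) \<times> (real ^ 'm). B *v fst z - snd z)"
  have lin: "linear f"
    unfolding f_def
    by (rule linearI) (auto simp: matrix_vector_right_distrib
        matrix_vector_mult_scaleR algebra_simps)
  define K where "K = convex_cone hull (f ` Basis)"
  have K_eq: "K = f ` {(x, s). 0 \<le> x \<and> 0 \<le> s}"
    by (simp only: K_def orthant_eq_convex_cone_hull convex_cone_hull_linear_image[OF lin])
  have K: "convex_cone K" "closed K"
    by (simp_all add: K_def convex_cone_convex_cone_hull closed_convex_cone_hull)
  have "d \<notin> K"
  proof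
    assume "d \<in> K"
    then obtain x s where "0 \<le> x" "0 \<le> s" "d = B *v x - s"
      by (auto simp: K_eq f_def)
    then have "0 \<le> x \<and> d \<le> B *v x"
      by (simp add: less_eq_vec_def)
    with assms show False by blast
  qed
  then obtain a \<beta> where sep: "a \<bullet> d < \<beta>" "\<And>k. k \<in> K \<Longrightarrow> \<beta> < a \<bullet> k"
    using separating_hyperplane_closed_point[of K d] K by (auto simp: convex_cone_def)
  have "0 \<in> K"
    using K(1) convex_cone_contains_0 by blast
  with sep(2)[of 0] have "\<beta> < 0" by simp
  \<comment> \<open>A functional bounded below on a cone is nonnegative there: otherwise some multiple of \<open>k\<close>
    would reach the forbidden value \<open>\<beta>\<close>.\<close>
  have nn: "0 \<le> a \<bullet> k" if "k \<in> K" for k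
  proof (rule ccontr)
    assume neg: "\<not> 0 \<le> a \<bullet> k"
    define c where "c = \<beta> / (a \<bullet> k)"
    have "0 \<le> c" "c * (a \<bullet> k) = \<beta>"
      using neg \<open>\<beta> < 0\<close> by (auto simp: c_def divide_nonpos_neg)
    moreover have "c *\<^sub>R k \<in> K"
      using K(1) that \<open>0 \<le> c\<close> by (simp add: convex_cone_def conic_def)
    ultimately show False
      using sep(2)[of "c *\<^sub>R k"] by simp
  qed
  \<comment> \<open>Testing \<open>a\<close> on the generators of \<open>K\<close>, the negated unit vectors and the columns of \<open>B\<close>,
    yields the two sign conditions that define the ray cone.\<close>
  have sgn_a: "a $ i \<le> 0" for i
  proof -
    have "- axis i 1 \<in> K"
      unfolding K_eq
      by (rule image_eqI[of _ _ "(0, axis i 1)"]) (auto simp: f_def less_eq_vec_def axis_def)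
    from nn[OF this] show ?thesis
      by (simp add: inner_axis)
  qed
  have col: "(transpose B *v a) $ j \<ge> 0" for j
  proof -
    have "B *v axis j 1 \<in> K"
      unfolding K_eq
      by (rule image_eqI[of _ _ "(axis j 1, 0)"]) (auto simp: f_def less_eq_vec_def axis_def)
    from nn[OF this] have "(transpose B *v a) \<bullet> axis j 1 \<ge> 0"
      by (simp add: dot_lmul_matrix)
    then show ?thesis
      by (simp add: inner_axis)
  qed
  show ?thesis
  proof
    have "transpose B *v (- a) = - (transpose B *v a)"
      using matrix_vector_mult_scaleR[of "transpose B" "-1" a] by simp
    then show "- a \<in> ray_cone B"
      using sgn_a col by (simp add: ray_cone_def less_eq_vec_def)
    show "d \<bullet> (- a) > 0"
      using sep(1) \<open>\<beta> < 0\<close> by (simp add: inner_commute)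
  qed
qed

text \<open>The maximisers form a compact face, and extreme points of a face are extreme in \<open>S\<close>.\<close>

lemma linear_max_at_extreme_point:
  fixes S :: "'a::euclidean_space set"
  assumes "compact S" "convex S" "S \<noteq> {}"
  obtains v where "v extreme_point_of S" "\<And>x. x \<in> S \<Longrightarrow> d \<bullet> x \<le> d \<bullet> v"
proof -
  obtain w where w: "w \<in> S" "\<And>x. x \<in> S \<Longrightarrow> d \<bullet> x \<le> d \<bullet> w"
    using continuous_attains_sup[OF assms(1,3), of "\<lambda>x. d \<bullet> x"]
    by (force intro: continuous_intros)
  define F where "F = S \<inter> {x. d \<bullet> x = d \<bullet> w}"
  have face: "F face_of S"
    unfolding F_def using assms(2) w(2) by (rule face_of_Int_supporting_hyperplane_le)
  have "compact F" "convex F" "F \<noteq> {}"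
    using assms w(1)
    by (auto simp: F_def intro!: compact_Int_closed closed_hyperplane convex_Int convex_hyperplane)
  then obtain v where v: "v extreme_point_of F"
    using extreme_point_exists_convex by blast
  with face have "v extreme_point_of S" "v \<in> F"
    by (auto simp: extreme_point_of_face)
  with w(2) that show ?thesis
    by (auto simp: F_def)
qed

text \<open>
  If \<open>r = u + v\<close> with nonzero \<open>u\<close> and \<open>v\<close>, then \<open>p = e \<bullet> u\<close> and \<open>q = e \<bullet> v\<close> are positive
  weights with sum 1, and \<open>r\<close> is the combination, with these weights, of the base points
  \<open>u / p\<close> and \<open>v / q\<close>.  Extremality makes both of them equal to \<open>r\<close>.
\<close>

lemma extreme_point_of_cone_base_generates_extreme_ray:
  assumes "conic R"
    and pos: "\<And>u. u \<in> R \<Longrightarrow> u \<noteq> 0 \<Longrightarrow> 0 < e \<bullet> u"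
    and ext: "r extreme_point_of (R \<inter> {u. e \<bullet> u = 1})"
  shows "generates_extreme_ray r R"
proof -
  have r: "r \<in> R" "e \<bullet> r = 1"
    using ext by (auto simp: extreme_point_of_def)
  have "(\<exists>c\<ge>0. u = c *\<^sub>R r) \<and> (\<exists>c\<ge>0. v = c *\<^sub>R r)"
    if uv: "u \<in> R" "v \<in> R" "r = u + v" for u v
  proof (cases "u = 0 \<or> v = 0")
    case True
    with uv(3) show ?thesis
      by (auto intro: exI[of _ 0] exI[of _ 1])
  next
    case False
    define p q where "p = e \<bullet> u" and "q = e \<bullet> v"
    have pq: "0 < p" "0 < q" "p + q = 1"
      using pos False uv r(2) by (auto simp: p_def q_def inner_add_right)
    define u' v' where "u' = (1 / p) *\<^sub>R u" and "v' = (1 / q) *\<^sub>R v"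
    have base: "u' \<in> R \<inter> {u. e \<bullet> u = 1}" "v' \<in> R \<inter> {u. e \<bullet> u = 1}"
      using \<open>conic R\<close> uv pq by (auto simp: u'_def v'_def p_def q_def conic_def)
    have uv': "u = p *\<^sub>R u'" "v = q *\<^sub>R v'"
      using pq by (auto simp: u'_def v'_def)
    have comb: "r = (1 - q) *\<^sub>R u' + q *\<^sub>R v'"
      using pq uv(3) uv' by (metis add_diff_cancel_right')
    have "u' = v'"
    proof (rule ccontr)
      assume "u' \<noteq> v'"
      then have "r \<in> open_segment u' v'"
        using comb pq by (auto simp: in_segment)
      with base ext show False
        by (auto simp: extreme_point_of_def)
    qed
    with comb have "u' = r" "v' = r"
      by (auto simp: algebra_simps)
    with uv' pq show ?thesis
      by (intro conjI exI[of _ p] exI[of _ q]) auto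
  qed
  with r show ?thesis
    by (auto simp: generates_extreme_ray_def)
qed

theorem lemma1:
  fixes A :: "real ^ 'p ^ 'm" and B :: "real ^ 'n ^ 'm" and b :: "real ^ 'm"
    and ybar :: "real ^ 'p"
  assumes "t_star A B b ybar > 0"
  shows "(\<forall>l. dual_optimal A B b ybar l \<longrightarrow> 1 \<bullet> l = 1) \<and>
    (\<exists>l. dual_optimal A B b ybar l \<and> l extreme_point_of slice B \<and>
      generates_extreme_ray l (ray_cone B))"
proof -
  define d where "d = rhs A b ybar"
  have optimal_iff: "dual_optimal A B b ybar l \<longleftrightarrow>
      l \<in> dual_feasible B \<and> (\<forall>l'\<in>dual_feasible B. d \<bullet> l' \<le> d \<bullet> l)" for l
    by (auto simp: dual_optimal_def is_arg_max_def d_def not_less)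
  \<comment> \<open>A solution \<open>x\<close> would be primal feasible with violation 0.\<close>
  have "\<nexists>x. 0 \<le> x \<and> d \<le> B *v x"
    using assms t_star_attained(2)[of _ 0 B A b ybar]
    by (fastforce simp: primal_feasible_def d_def)
  then obtain l0 where l0: "l0 \<in> ray_cone B" "d \<bullet> l0 > 0"
    by (rule farkas)
  have normalise: "(1 / (1 \<bullet> l)) *\<^sub>R l \<in> slice B" if "l \<in> ray_cone B" "l \<noteq> 0" for l
    using conic_ray_cone[of B] sum_pos_ray_cone[OF that] that(1)
    by (auto simp: slice_eq conic_def)
  have "l0 \<noteq> 0" using l0(2) by auto
  then have s0: "(1 / (1 \<bullet> l0)) *\<^sub>R l0 \<in> slice B"
    using normalise l0(1) by blast
  then obtain v where ext: "v extreme_point_of slice B"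
    and max: "\<And>x. x \<in> slice B \<Longrightarrow> d \<bullet> x \<le> d \<bullet> v"
    using linear_max_at_extreme_point[OF compact_convex_slice] by blast
  have v_pos: "d \<bullet> v > 0"
    using max[OF s0] l0(2) sum_pos_ray_cone[OF l0(1) \<open>l0 \<noteq> 0\<close>]
    by (smt (verit) divide_pos_pos inner_scaleR_right mult_pos_pos)
  have v_slice: "v \<in> slice B"
    using ext by (simp add: extreme_point_of_def)
  have bound: "d \<bullet> l \<le> (1 \<bullet> l) * (d \<bullet> v)" if "l \<in> ray_cone B" for l
  proof (cases "l = 0")
    case False
    with max[OF normalise[OF that]] sum_pos_ray_cone[OF that] show ?thesis
      by (simp add: field_simps)
  qed simp
  \<comment> \<open>Lowering \<open>1 \<bullet> l\<close> below 1 can only lower the bound, as \<open>d \<bullet> v\<close> is positive.\<close>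
  have opt: "dual_optimal A B b ybar v"
    unfolding optimal_iff
  proof (intro conjI ballI)
    show "v \<in> dual_feasible B"
      using v_slice by (simp add: slice_eq dual_feasible_eq)
    fix l assume "l \<in> dual_feasible B"
    then have "l \<in> ray_cone B" "1 \<bullet> l \<le> 1"
      by (auto simp: dual_feasible_eq)
    with bound[of l] v_pos show "d \<bullet> l \<le> d \<bullet> v"
      by (smt (verit) mult_left_le_one_le mult_le_cancel_right1)
  qed
  have "1 \<bullet> l = 1" if "dual_optimal A B b ybar l" for l
  proof -
    have l: "l \<in> ray_cone B" "1 \<bullet> l \<le> 1" "d \<bullet> v \<le> d \<bullet> l"
      using that opt by (auto simp: optimal_iff dual_feasible_eq)
    with bound[of l] have "1 * (d \<bullet> v) \<le> (1 \<bullet> l) * (d \<bullet> v)"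
      by simp
    then have "1 \<le> 1 \<bullet> l"
      using v_pos by (simp only: mult_le_cancel_right_pos)
    with l(2) show ?thesis by simp
  qed
  moreover have "generates_extreme_ray v (ray_cone B)"
    using conic_ray_cone sum_pos_ray_cone ext unfolding slice_eq
    by (rule extreme_point_of_cone_base_generates_extreme_ray)
  ultimately show ?thesis
    using opt ext by blast
qed

end
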